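(* Let $k \ge 2$ be an integer, and let $G=(V,E)$ be a finite simple graph whose edges are each colored blue or red, such that every vertex in $V$ belongs to a monochromatic $k$-clique of each color (that is, every vertex lies in some $k$-clique all of whose edges are blue, and in some $k$-clique all of whose edges are red). Then $|V| \ge 4(k-1)$.
   Context: A $k$-clique is a set of $k$ pairwise adjacent vertices; it is monochromatic of a given color if all edges among its vertices have that color. *)

theory Defs
  imports "HOL-Library.Ramsey"
begin

datatype color = Blue | Red

definition k_clique :: "'a set \<Rightarrow> 'a set set \<Rightarrow> nat \<Rightarrow> 'a set \<Rightarrow> bool" where
  "k_clique V E k K \<longleftrightarrow> K \<in> [V]\<^bsup>k\<^esup> \<and> clique K E"

definition mono_clique ::
  "'a set \<Rightarrow> 'a set set \<Rightarrow> ('a set \<Rightarrow> color) \<Rightarrow> color \<Rightarrow> nat \<Rightarrow> 'a set \<Rightarrow> bool" where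
  "mono_clique V E col c k K \<longleftrightarrow> k_clique V E k K \<and> (\<forall>e \<in> [K]\<^bsup>2\<^esup>. col e = c)"

end

theory Submission
  imports Defs
begin

text \<open>
  A blue and a red clique share at most one vertex. Starting from a single clique, keep adding
  a clique of the missing colour at a vertex covered in one colour only; each step doubly covers
  at least one new vertex, so this ends with \<open>p\<close> blue and \<open>q\<close> red cliques that cover
  the same set \<open>W\<close> and satisfy \<open>p + q \<le> |W| + 1\<close>. If \<open>f v, g v \<ge> 1\<close> count the chosen
  blue and red cliques through \<open>v\<close>, summing \<open>(f v - 1) (g v - 1) \<ge> 0\<close> over \<open>W\<close> gives
  \<open>|W| \<ge> k (p + q) - p q = k\<^sup>2 - (p - k) (q - k)\<close>. Since \<open>p, q \<ge> k\<close>, assuming \<open>|W| < 4 (k - 1)\<close> would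
  yield \<open>(p - k) (q - k) \<le> (k - 2)\<^sup>2\<close> and thus \<open>|W| \<ge> k\<^sup>2 - (k - 2)\<^sup>2 = 4 (k - 1)\<close>.
\<close>

text \<open>An extremal choice replaces the step-by-step enlargement: among the pairs meeting the
  counting bound, one of largest total size must have equal unions.\<close>

lemma ex_subfamilies_same_Union:
  assumes fin: "finite (\<Union>\<A>)" and un: "\<Union>\<A> = \<Union>\<B>" and ne: "\<A> \<noteq> {}"
  obtains \<F> \<G> where "\<F> \<subseteq> \<A>" "\<G> \<subseteq> \<B>" "\<F> \<noteq> {} \<or> \<G> \<noteq> {}" "\<Union>\<F> = \<Union>\<G>"
    "card \<F> + card \<G> \<le> card (\<Union>\<F>) + 1"
proof -
  have finA: "finite \<A>" using fin by (rule finite_UnionD)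
  have finB: "finite \<B>" using fin un by (metis finite_UnionD)
  \<comment> \<open>The bound counts only points covered by both families, so it makes sense while
    the unions still differ. The \<open>+ 1\<close> pays for the first member, which has no common
    points yet.\<close>
  define P where "P = (\<lambda>(\<F>, \<G>). \<F> \<subseteq> \<A> \<and> \<G> \<subseteq> \<B> \<and>
    card \<F> + card \<G> \<le> card (\<Union>\<F> \<inter> \<Union>\<G>) + 1)"
  define m where "m = (\<lambda>(\<F> :: 'a set set, \<G> :: 'a set set). card \<F> + card \<G>)"
  obtain A where A: "A \<in> \<A>" using ne by blast
  have init: "P ({A}, {})" using A by (simp add: P_def)
  have bound: "\<forall>x. P x \<longrightarrow> m x < card \<A> + card \<B> + 1"
    using finA finB by (auto simp: P_def m_def less_Suc_eq_le intro!: add_mono card_mono)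
  obtain \<F> \<G> where FG: "P (\<F>, \<G>)" and max: "\<And>x. P x \<Longrightarrow> m x \<le> m (\<F>, \<G>)"
    using ex_has_greatest_nat[OF init bound] by auto
  have sub: "\<F> \<subseteq> \<A>" "\<G> \<subseteq> \<B>" and c: "card \<F> + card \<G> \<le> card (\<Union>\<F> \<inter> \<Union>\<G>) + 1"
    using FG by (auto simp: P_def)
  have finFG: "finite \<F>" "finite \<G>" using sub finA finB finite_subset by auto
  have finU: "finite (\<Union>\<F>)" "finite (\<Union>\<G>)"
    using sub fin un finite_subset Union_mono by metis+
  have "\<Union>\<F> \<subseteq> \<Union>\<G>"
  proof
    fix v assume v: "v \<in> \<Union>\<F>"
    show "v \<in> \<Union>\<G>"
    proof (rule ccontr)
      assume nv: "v \<notin> \<Union>\<G>"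
      obtain B where B: "B \<in> \<B>" "v \<in> B" using v sub un by blast
      then have new: "B \<notin> \<G>" using nv by blast
      \<comment> \<open>Adding \<open>B\<close> makes \<open>v\<close> a common point, so both sides
        of the bound can absorb one more member, against the maximality of the pair.\<close>
      have "insert v (\<Union>\<F> \<inter> \<Union>\<G>) \<subseteq> \<Union>\<F> \<inter> \<Union>(insert B \<G>)" using v B by auto
      then have "card (insert v (\<Union>\<F> \<inter> \<Union>\<G>)) \<le> card (\<Union>\<F> \<inter> \<Union>(insert B \<G>))"
        by (rule card_mono[rotated]) (use finU in blast)
      then have "P (\<F>, insert B \<G>)" using c new nv B sub finFG finU by (auto simp: P_def)
      from max[OF this] show False using new finFG by (simp add: m_def)
    qed
  qed
  moreover have "\<Union>\<G> \<subseteq> \<Union>\<F>"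
  proof
    fix v assume v: "v \<in> \<Union>\<G>"
    show "v \<in> \<Union>\<F>"
    proof (rule ccontr)
      assume nv: "v \<notin> \<Union>\<F>"
      obtain B where B: "B \<in> \<A>" "v \<in> B" using v sub un by blast
      then have new: "B \<notin> \<F>" using nv by blast
      have "insert v (\<Union>\<F> \<inter> \<Union>\<G>) \<subseteq> \<Union>(insert B \<F>) \<inter> \<Union>\<G>" using v B by auto
      then have "card (insert v (\<Union>\<F> \<inter> \<Union>\<G>)) \<le> card (\<Union>(insert B \<F>) \<inter> \<Union>\<G>)"
        by (rule card_mono[rotated]) (use finU in blast)
      then have "P (insert B \<F>, \<G>)" using c new nv B sub finFG finU by (auto simp: P_def)
      from max[OF this] show False using new finFG by (simp add: m_def)
    qed
  qed
  ultimately have eq: "\<Union>\<F> = \<Union>\<G>" by blast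
  \<comment> \<open>The starting pair has total size 1, so the maximal pair is not empty on both
    sides.\<close>
  have "\<F> \<noteq> {} \<or> \<G> \<noteq> {}" using max[OF init] by (auto simp: m_def)
  then show thesis using that sub eq c by simp
qed

lemma card_eq_sum_of_bool:
  assumes "finite W" "B \<subseteq> W"
  shows "int (card B) = (\<Sum>v\<in>W. of_bool (v \<in> B))"
  using assms by (simp add: Int_absorb1 Int_def[symmetric] sum.If_cases of_bool_def)

text \<open>Double counting: a point covered \<open>f v\<close> and \<open>g v\<close> times
  satisfies \<open>f v * g v \<ge> f v + g v - 1\<close>, while each pair \<open>A\<close>,
  \<open>B\<close> contributes at most one common point to the sum of the products.\<close>

lemma cross_intersecting_covers_card:
  assumes fin: "finite W" and F: "\<Union>\<F> = W" and G: "\<Union>\<G> = W"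
    and kF: "\<And>A. A \<in> \<F> \<Longrightarrow> card A = k" and kG: "\<And>B. B \<in> \<G> \<Longrightarrow> card B = k"
    and meet: "\<And>A B. A \<in> \<F> \<Longrightarrow> B \<in> \<G> \<Longrightarrow> card (A \<inter> B) \<le> 1"
  shows "k * (card \<F> + card \<G>) \<le> card W + card \<F> * card \<G>"
proof -
  define f where "f v = (\<Sum>A\<in>\<F>. of_bool (v \<in> A) :: int)" for v
  define g where "g v = (\<Sum>B\<in>\<G>. of_bool (v \<in> B) :: int)" for v
  have finFG: "finite \<F>" "finite \<G>" using fin F G finite_UnionD by metis+
  have f1: "f v \<ge> 1" if v: "v \<in> W" for v
  proof -
    obtain A where A: "A \<in> \<F>" "v \<in> A" using v F by blast
    then have "of_bool (v \<in> A) \<le> f v" unfolding f_def by (intro member_le_sum) (use finFG in auto)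
    then show ?thesis using A by simp
  qed
  have g1: "g v \<ge> 1" if v: "v \<in> W" for v
  proof -
    obtain A where A: "A \<in> \<G>" "v \<in> A" using v G by blast
    then have "of_bool (v \<in> A) \<le> g v" unfolding g_def by (intro member_le_sum) (use finFG in auto)
    then show ?thesis using A by simp
  qed
  have sf: "(\<Sum>v\<in>W. f v) = int (card \<F> * k)"
  proof -
    have "(\<Sum>v\<in>W. f v) = (\<Sum>A\<in>\<F>. \<Sum>v\<in>W. of_bool (v \<in> A))" unfolding f_def by (rule sum.swap)
    also have "\<dots> = (\<Sum>A\<in>\<F>. int k)"
      using card_eq_sum_of_bool[OF fin] kF F by (intro sum.cong refl) (metis Union_upper)
    finally show ?thesis by simp
  qed
  have sg: "(\<Sum>v\<in>W. g v) = int (card \<G> * k)"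
  proof -
    have "(\<Sum>v\<in>W. g v) = (\<Sum>A\<in>\<G>. \<Sum>v\<in>W. of_bool (v \<in> A))" unfolding g_def by (rule sum.swap)
    also have "\<dots> = (\<Sum>A\<in>\<G>. int k)"
      using card_eq_sum_of_bool[OF fin] kG G by (intro sum.cong refl) (metis Union_upper)
    finally show ?thesis by simp
  qed
  \<comment> \<open>Both sides count the triples \<open>v\<close>, \<open>A\<close>,
    \<open>B\<close> with \<open>v\<close> in \<open>A \<inter> B\<close>; summing over
    \<open>v\<close> first brings in the intersection sizes.\<close>
  have "(\<Sum>v\<in>W. f v * g v) = (\<Sum>v\<in>W. \<Sum>A\<in>\<F>. \<Sum>B\<in>\<G>. of_bool (v \<in> A \<inter> B))"
    unfolding f_def g_def sum_product by (simp add: of_bool_conj)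
  also have "\<dots> = (\<Sum>A\<in>\<F>. \<Sum>B\<in>\<G>. \<Sum>v\<in>W. of_bool (v \<in> A \<inter> B))"
    by (subst sum.swap) (intro sum.cong refl sum.swap)
  also have "\<dots> = (\<Sum>A\<in>\<F>. \<Sum>B\<in>\<G>. int (card (A \<inter> B)))"
    by (intro sum.cong refl card_eq_sum_of_bool[OF fin, symmetric]) (use F in blast)
  also have "\<dots> \<le> (\<Sum>A\<in>\<F>. \<Sum>B\<in>\<G>. 1)"
    by (intro sum_mono) (use meet in force)
  finally have prod: "(\<Sum>v\<in>W. f v * g v) \<le> int (card \<F> * card \<G>)" by simp
  have "0 \<le> (\<Sum>v\<in>W. (f v - 1) * (g v - 1))"
    by (intro sum_nonneg mult_nonneg_nonneg) (metis f1 g1 diff_ge_0_iff_ge)+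
  also have "\<dots> = (\<Sum>v\<in>W. f v * g v) - (\<Sum>v\<in>W. f v) - (\<Sum>v\<in>W. g v) + int (card W)"
    by (simp add: algebra_simps sum.distrib sum_subtractf)
  finally have "int (card \<F> * k) + int (card \<G> * k) \<le> int (card W) + int (card \<F> * card \<G>)"
    using prod sf sg by linarith
  then show ?thesis by (simp only: of_nat_add[symmetric] of_nat_le_iff) (simp add: algebra_simps)
qed

text \<open>Each member covers at most one point of \<open>B\<close>. Applied to a clique of the
  other colour, this yields at least \<open>k\<close> chosen cliques of each colour.\<close>

lemma card_le_card_cover:
  assumes fin: "finite \<F>" and sub: "B \<subseteq> \<Union>\<F>" and meet: "\<And>A. A \<in> \<F> \<Longrightarrow> card (A \<inter> B) \<le> 1"
  shows "card B \<le> card \<F>"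
proof -
  have "B = (\<Union>A\<in>\<F>. A \<inter> B)" using sub by blast
  then have "card B \<le> (\<Sum>A\<in>\<F>. card (A \<inter> B))" using card_UN_le[OF fin] by metis
  also have "\<dots> \<le> (\<Sum>A\<in>\<F>. 1)" by (intro sum_mono meet)
  finally show ?thesis by simp
qed

lemma four_mult_le_of_count:
  fixes k n p q :: nat
  assumes k: "2 \<le> k" and p: "k \<le> p" and q: "k \<le> q"
    and pq: "p + q \<le> n + 1" and n: "k * (p + q) \<le> n + p * q"
  shows "4 * (k - 1) \<le> n"
proof (rule ccontr)
  assume *: "\<not> 4 * (k - 1) \<le> n"
  obtain x y j where xy: "p = k + x" "q = k + y" "k = j + 2"
    using p q k by (metis le_Suc_ex add.commute)
  \<comment> \<open>If \<open>n \<le> 4 * j + 3\<close>, then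
    \<open>2 * j + 4 + x + y = p + q \<le> 4 * j + 4\<close>. The bound on \<open>x * y\<close>
    below is then AM-GM.\<close>
  have s: "x + y \<le> 2 * j" using * pq xy by simp
  have "4 * (int x * int y) \<le> (int x + int y)\<^sup>2"
    using zero_le_power2[of "int x - int y"] by (simp add: power2_eq_square algebra_simps)
  also have "\<dots> \<le> (2 * int j)\<^sup>2" by (rule power_mono) (use s in linarith)+
  finally have "int x * int y \<le> int j * int j" by (simp add: power2_eq_square)
  then have "x * y \<le> j * j" by (simp only: of_nat_mult[symmetric] of_nat_le_iff)
  moreover have "k * k \<le> n + x * y" using n xy(1,2) by (simp add: algebra_simps)
  ultimately show False using * xy(3) by (simp add: algebra_simps)
qed

text \<open>Two common vertices would span a pair inside both cliques, which would need both
  colours.\<close>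

lemma mono_clique_inter_card_le_1:
  assumes "mono_clique V E col c k A" "mono_clique V E col d l B" "c \<noteq> d"
  shows "card (A \<inter> B) \<le> 1"
proof -
  have "u = v" if "u \<in> A \<inter> B" "v \<in> A \<inter> B" for u v
  proof (rule ccontr)
    assume "u \<noteq> v"
    then have "{u, v} \<in> [A]\<^bsup>2\<^esup>" "{u, v} \<in> [B]\<^bsup>2\<^esup>" using that by (auto simp: nsets_def)
    then show False using assms unfolding mono_clique_def by metis
  qed
  \<comment> \<open>The infinite case is settled by the convention that \<open>card\<close> is then
    0.\<close>
  then show ?thesis by (metis One_nat_def card_le_Suc0_iff_eq card.infinite le0)
qed

theorem theorem1:
  fixes V :: "'a set" and E :: "'a set set" and col :: "'a set \<Rightarrow> color" and k :: nat
  assumes "k \<ge> 2"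
    and "finite V" and "V \<noteq> {}"
    and "E \<subseteq> [V]\<^bsup>2\<^esup>"
    and "\<forall>v\<in>V. \<forall>c. \<exists>K. mono_clique V E col c k K \<and> v \<in> K"
  shows "card V \<ge> 4 * (k - 1)"
proof -
  define \<C> where "\<C> c = {K. mono_clique V E col c k K}" for c
  have sub: "K \<subseteq> V" and size: "card K = k" if "K \<in> \<C> c" for K c
    using that by (auto simp: \<C>_def mono_clique_def k_clique_def nsets_def)
  have cov: "\<Union>(\<C> c) = V" for c using sub assms(5) by (fastforce simp: \<C>_def)
  have "\<C> Blue \<noteq> {}" using cov assms(3) by fastforce
  moreover have "finite (\<Union>(\<C> Blue))" "\<Union>(\<C> Blue) = \<Union>(\<C> Red)" using cov assms(2) by simp_all
  ultimately obtain \<F> \<G> where FG: "\<F> \<subseteq> \<C> Blue" "\<G> \<subseteq> \<C> Red" "\<F> \<noteq> {} \<or> \<G> \<noteq> {}" "\<Union>\<F> = \<Union>\<G>"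
    and c: "card \<F> + card \<G> \<le> card (\<Union>\<F>) + 1"
    by (metis ex_subfamilies_same_Union)
  have W: "\<Union>\<F> \<subseteq> V" using FG(1) cov by blast
  have finW: "finite (\<Union>\<F>)" using W assms(2) finite_subset by blast
  have fin: "finite \<F>" "finite \<G>" using finW FG(4) finite_UnionD by metis+
  have kF: "card A = k" if "A \<in> \<F>" for A using that FG(1) size by blast
  have kG: "card B = k" if "B \<in> \<G>" for B using that FG(2) size by blast
  have meet: "card (A \<inter> B) \<le> 1" if "A \<in> \<F>" "B \<in> \<G>" for A B
    using that FG(1,2) mono_clique_inter_card_le_1[of V E col Blue k A Red k B]
    by (auto simp: \<C>_def)
  \<comment> \<open>With no empty members, an empty family on one side would make the common union
    empty and hence the other family empty too; so both families are nonempty.\<close>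
  have "{} \<notin> \<F>" "{} \<notin> \<G>" using kF kG assms(1) by fastforce+
  then obtain A B where AB: "A \<in> \<F>" "B \<in> \<G>" using FG(3,4) by (metis Union_empty_conv all_not_in_conv)
  have "B \<subseteq> \<Union>\<F>" "A \<subseteq> \<Union>\<G>" using AB FG(4) by blast+
  then have "k \<le> card \<F>" "k \<le> card \<G>"
    using card_le_card_cover[OF fin(1), of B] card_le_card_cover[OF fin(2), of A] meet AB kF kG
    by (metis Int_commute)+
  moreover have "k * (card \<F> + card \<G>) \<le> card (\<Union>\<F>) + card \<F> * card \<G>"
    using cross_intersecting_covers_card[OF finW refl FG(4)[symmetric] kF kG meet] .
  ultimately have "4 * (k - 1) \<le> card (\<Union>\<F>)"
    using four_mult_le_of_count assms(1) c by blast
  also have "\<dots> \<le> card V" using W assms(2) by (rule card_mono[rotated])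
  finally show ?thesis .
qed

end
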